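(* Let $T$ be a rooted tree of size $s$ with descent set $V_D$ such that its root $r$ is not in $V_D$ but all of the children of $r$ are in $V_D$, and let $h=s-1=\deg d(T;n)$. Then $$ d(T;n)=\sum_{k=1}^{h}a_k(T)\binom{n-h}{k}, $$ where the coefficient $a_k(T)$ is the number of labelings $w$ in $D(T;2h)$ such that $\{w_1,\dots,w_h\}\cap[h+1,2h]=[h+1,h+k]$, where $w_1,\dots,w_h$ are the labels under $w$ of the vertices of $T$ in $V\setminus\{r\}$.
   Context: $T$ is a rooted tree with vertex set $V$ of size $s$; $p(v)$ is the parent of a non-root vertex $v$. $T$ comes with a distinguished subset $V_D\subseteq V$ (its descent set), whose elements are called descent vertices; all other vertices are ascent vertices. For an integer $n\ge s$, $G(T;n)$ is the rooted tree with $n$ vertices obtained by adding a chain of $n-s$ vertices above the root of $T$; the added vertices are ascent vertices. A labeling of a rooted tree with $m$ vertices is a bijection $w$ from its vertices to $[m]=\{1,\dots,m\}$, and $\mathrm{Des}(w)$ is the set of non-root vertices $v$ with $w(v)>w(p(v))$. $D(T;n)$ is the set of labelings $w$ of $G(T;n)$ with $\mathrm{Des}(w)=V_D$, and $d(T;n)=|D(T;n)|$. The function $d(T;n)$ is a polynomial in $n$, and $\deg d(T;n)$ denotes its degree; this degree is the sum, over the descent vertices $v$ having no proper ancestor in $V_D$, of the number of vertices in the subtree of $T$ rooted at $v$. $[a,b]$ denotes the set of integers $\{a,a+1,\dots,b\}$. Binomial coefficients $\binom{n-h}{k}$ are regarded as polynomials in $n$.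
   Formalization: The tree is assumed to have size s ≥ 2 (h ≥ 1): for the one-vertex tree all hypotheses hold and d(T;n)=1, but the sum over k from 1 to h=0 is empty, so the formula fails there. *)

theory Defs
  imports Complex_Main "HOL-Library.FuncSet" "HOL-Computational_Algebra.Polynomial"
begin

record 'a dtree =
  verts :: "'a set"
  root_of :: 'a
  parent :: "'a \<Rightarrow> 'a"
  descents :: "'a set"

(* The value of the parent function at the root and outside the vertex set is irrelevant.
   The last condition excludes cycles: on a cycle of parents avoiding the root, no iterate
   is the root. *)
definition rooted_tree :: "'a dtree \<Rightarrow> bool" where
  "rooted_tree T \<longleftrightarrow>
     finite (verts T) \<and> root_of T \<in> verts T \<and> descents T \<subseteq> verts T \<and>
     (\<forall>v \<in> verts T - {root_of T}. parent T v \<in> verts T) \<and>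
     (\<forall>v \<in> verts T. \<exists>i. (parent T ^^ i) v = root_of T)"

definition children :: "'a dtree \<Rightarrow> 'a \<Rightarrow> 'a set" where
  "children T u = {v \<in> verts T - {root_of T}. parent T v = u}"

(* The tree G(T;n), for n >= s = card (verts T). The vertices of T are tagged by Inl; the added
   vertices are Inr 0, ..., Inr (n - s - 1), from bottom to top, Inr 0 being the parent of the
   root of T. For n = s there are none, and the root is still that of T. *)
definition chain_ext :: "'a dtree \<Rightarrow> nat \<Rightarrow> ('a + nat) dtree" where
  "chain_ext T n = (let m = n - card (verts T) in
     \<lparr>verts = Inl ` verts T \<union> Inr ` {..<m},
      root_of = (if m = 0 then Inl (root_of T) else Inr (m - 1)),
      parent = (\<lambda>x. case x of
                  Inl v \<Rightarrow> if v = root_of T then Inr 0 else Inl (parent T v)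
                | Inr i \<Rightarrow> Inr (Suc i)),
      descents = Inl ` descents T\<rparr>)"

(* Extensionality makes two labelings equal exactly when they agree on the vertices, so that
   they can be counted. *)
definition labelings :: "'a dtree \<Rightarrow> ('a \<Rightarrow> nat) set" where
  "labelings T = {w \<in> extensional (verts T). bij_betw w (verts T) {1..card (verts T)}}"

definition Des :: "'a dtree \<Rightarrow> ('a \<Rightarrow> nat) \<Rightarrow> 'a set" where
  "Des T w = {v \<in> verts T - {root_of T}. w v > w (parent T v)}"

definition D :: "'a dtree \<Rightarrow> nat \<Rightarrow> ('a + nat \<Rightarrow> nat) set" where
  "D T n = {w \<in> labelings (chain_ext T n). Des (chain_ext T n) w = descents (chain_ext T n)}"

definition d :: "'a dtree \<Rightarrow> nat \<Rightarrow> nat" where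
  "d T n = card (D T n)"

(* d(T;n) as a polynomial in n: a polynomial is determined by its values at all n >= s. *)
definition d_poly :: "'a dtree \<Rightarrow> rat poly" where
  "d_poly T = (THE q. \<forall>n \<ge> card (verts T). poly q (of_nat n) = of_nat (d T n))"

definition a_coeff :: "'a dtree \<Rightarrow> nat \<Rightarrow> nat" where
  "a_coeff T k = (let h = card (verts T) - 1 in
     card {w \<in> D T (2 * h).
             w ` Inl ` (verts T - {root_of T}) \<inter> {h+1..2*h} = {h+1..h+k}})"

end

theory Submission
  imports Defs
begin

text \<open>
  Let F be the forest obtained from the tree by deleting its root; it has h vertices. The root and
  the chain above it consist of ascent vertices, so in a labeling counted by d(T;n) their labels
  increase upwards. Hence a labeling is determined by its restriction f to F: the labels
  that f does not use are put on the chain in increasing order. The root receives the smallest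
  unused label, so the descent at a child v of the root says that some label
  below f(v) is unused.

  Now split the range of labels into {1..h} and the rest, and let B be the set of labels above h
  that f uses. The set B is nonempty: otherwise f uses exactly {1..h}, and a child of the root has
  no unused label below its own. Therefore the least unused label lies in {1..h}, and whether
  the descent conditions hold depends only on the labels in {1..h} and on the relative order of
  the labels in B. So the number of admissible f with a given B depends only on k = |B|
  (lemma \<open>card_forest_labelings_with_le\<close>); for B = {h+1..h+k} it is the
  number a(k) of the statement. Inside {h+1..n} there are \<open>(n - h) choose k\<close> sets of size k,
  and summing over B gives the formula for every n (lemma \<open>d_eq_sum\<close>).

  The formula extends to a polynomial identity, because a polynomial is determined by its values at
  large natural numbers. The degree is h since a(h) is positive (lemma \<open>a_coeff_top_pos\<close>): when F
  uses only labels above h, all conditions at the children of the root hold automatically,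
  and any descent set on a rooted forest is realized by some labeling.
\<close>

section \<open>Order isomorphisms of finite linear orders\<close>

lemma ex_strict_mono_bij:
  fixes A :: "'a::linorder set" and B :: "'b::linorder set"
  assumes "finite A" "finite B" "card A = card B"
  obtains g where "strict_mono_on A g" "bij_betw g A B"
proof -
  define rank where "rank x = card {a \<in> A. a < x}" for x
  define g where "g x = sorted_list_of_set B ! rank x" for x
  have rank_less: "rank x < card B" if "x \<in> A" for x
    unfolding rank_def assms(3)[symmetric]
    by (rule psubset_card_mono) (use assms that in auto)
  have rank_mono: "rank x < rank y" if "x \<in> A" "x < y" for x y
    unfolding rank_def
  proof (rule psubset_card_mono)
    show "finite {a \<in> A. a < y}" using assms by simp
    have "x \<in> {a \<in> A. a < y}" "x \<notin> {a \<in> A. a < x}" using that by auto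
    moreover have "{a \<in> A. a < x} \<subseteq> {a \<in> A. a < y}" using that by auto
    ultimately show "{a \<in> A. a < x} \<subset> {a \<in> A. a < y}" by blast
  qed
  have mono: "strict_mono_on A g"
  proof (rule strict_mono_onI)
    fix x y assume "x \<in> A" "y \<in> A" "x < y"
    then show "g x < g y"
      unfolding g_def
      using rank_mono[of x y] rank_less[of y] strict_sorted_list_of_set[of B]
      by (simp add: sorted_wrt_nth_less)
  qed
  have "g x \<in> B" if "x \<in> A" for x
    using rank_less[OF that] assms(2) nth_mem[of "rank x" "sorted_list_of_set B"]
    by (simp add: g_def)
  then have "g ` A \<subseteq> B" by blast
  moreover have "inj_on g A" using mono by (rule strict_mono_on_imp_inj_on)
  ultimately have "bij_betw g A B"
    using assms by (simp add: bij_betw_def card_image card_subset_eq)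
  with mono show thesis by (rule that)
qed

lemma strict_mono_on_atMost_unique:
  fixes f g :: "nat \<Rightarrow> 'a::linorder"
  assumes "strict_mono_on {..N} f" "strict_mono_on {..N} g" "f ` {..N} = g ` {..N}" "j \<le> N"
  shows "f j = g j"
proof -
  have sorted: "sorted_wrt (<) (map k [0..<Suc N])" if "strict_mono_on {..N} k"
    for k :: "nat \<Rightarrow> 'a"
    using that by (auto simp: sorted_wrt_iff_nth_less strict_mono_on_def simp del: upt_Suc)
  have "map f [0..<Suc N] = map g [0..<Suc N]"
    using sorted[OF assms(1)] sorted[OF assms(2)] assms(3)
    by (intro strict_sorted_equal)
       (auto simp: atLeast0LessThan lessThan_Suc_atMost simp del: upt_Suc)
  then show ?thesis using assms(4) by (simp add: map_eq_conv del: upt_Suc)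
qed

section \<open>Labelings determined by the forest below the root\<close>

locale tree_with_descent_children =
  fixes T :: "'a dtree"
  assumes tree: "rooted_tree T"
    and two_verts: "card (verts T) \<ge> 2"
    and root_ascent: "root_of T \<notin> descents T"
    and children_descents: "children T (root_of T) \<subseteq> descents T"
begin

definition forest :: "'a set" where
  "forest = verts T - {root_of T}"

definition h :: nat where
  "h = card forest"

text \<open>The chain of G(T;n), from bottom to top, together with the root of T as its lowest vertex;
  this is the part of G(T;n) whose labels are forced to increase.\<close>
definition spine :: "nat \<Rightarrow> 'a + nat" where
  "spine j = (case j of 0 \<Rightarrow> Inl (root_of T) | Suc i \<Rightarrow> Inr i)"

lemma spine_simps [simp]: "spine 0 = Inl (root_of T)" "spine (Suc i) = Inr i"
  by (simp_all add: spine_def)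

lemma fin_verts: "finite (verts T)" and root_in: "root_of T \<in> verts T"
  and descents_sub: "descents T \<subseteq> verts T"
  using tree by (auto simp: rooted_tree_def)

lemma parent_in: "v \<in> forest \<Longrightarrow> parent T v \<in> verts T"
  using tree by (auto simp: rooted_tree_def forest_def)

lemma fin_forest: "finite forest"
  using fin_verts by (simp add: forest_def)

lemma card_verts: "card (verts T) = Suc h"
  unfolding h_def forest_def using fin_verts root_in
  by (metis card_Suc_Diff1)

lemma h_pos: "h \<ge> 1"
  using two_verts card_verts by simp

lemma root_notin_forest: "root_of T \<notin> forest"
  by (simp add: forest_def)

lemma verts_eq: "verts T = insert (root_of T) forest"
  using root_in by (auto simp: forest_def)

lemma child_descent: "v \<in> forest \<Longrightarrow> parent T v = root_of T \<Longrightarrow> v \<in> descents T"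
  using children_descents by (auto simp: children_def forest_def)

lemma inj_spine: "inj spine"
  by (auto simp: inj_def spine_def split: nat.splits)

lemma verts_chain_ext:
  assumes "n \<ge> Suc h"
  shows "verts (chain_ext T n) = Inl ` forest \<union> spine ` {..n - Suc h}"
proof -
  have "{..n - Suc h} = insert 0 (Suc ` {..<n - Suc h})"
    by (metis lessThan_Suc_atMost lessThan_Suc_eq_insert_0)
  then have "spine ` {..n - Suc h} = insert (Inl (root_of T)) (Inr ` {..<n - Suc h})"
    by (simp add: image_image)
  moreover have "verts (chain_ext T n) = Inl ` verts T \<union> Inr ` {..<n - Suc h}"
    by (simp add: chain_ext_def Let_def card_verts)
  ultimately show ?thesis by (simp add: verts_eq)
qed

lemma card_verts_chain_ext:
  assumes "n \<ge> Suc h"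
  shows "card (verts (chain_ext T n)) = n"
proof -
  have "Inl ` forest \<inter> spine ` {..n - Suc h} = {}"
    using root_notin_forest by (auto simp: spine_def split: nat.splits)
  then have "card (verts (chain_ext T n)) =
      card (Inl ` forest :: ('a + nat) set) + card (spine ` {..n - Suc h})"
    unfolding verts_chain_ext[OF assms] using fin_forest by (intro card_Un_disjoint) auto
  also have "\<dots> = h + Suc (n - Suc h)"
    using inj_spine by (simp add: card_image h_def inj_on_def)
  finally show ?thesis using assms by simp
qed

text \<open>All vertices of the spine are ascents, so along it the descent condition is monotonicity.
  Only the forest vertices keep a descent condition of their own.\<close>
lemma mem_D_iff:
  assumes "n \<ge> Suc h"
  shows "w \<in> D T n \<longleftrightarrow>
    w \<in> extensional (Inl ` forest \<union> spine ` {..n - Suc h}) \<and>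
    bij_betw w (Inl ` forest \<union> spine ` {..n - Suc h}) {1..n} \<and>
    strict_mono_on {..n - Suc h} (w \<circ> spine) \<and>
    (\<forall>v\<in>forest. w (Inl v) > w (Inl (parent T v)) \<longleftrightarrow> v \<in> descents T)"
    (is "_ \<longleftrightarrow> ?ext \<and> ?bij \<and> ?mono \<and> ?desc")
proof -
  let ?N = "n - Suc h"
  let ?G = "chain_ext T n"
  have root: "root_of ?G = spine ?N"
    by (auto simp: chain_ext_def Let_def card_verts spine_def split: nat.split)
  have par_spine: "parent ?G (spine j) = spine (Suc j)" for j
    by (cases j) (auto simp: chain_ext_def Let_def)
  have par_forest: "parent ?G (Inl v) = Inl (parent T v)" if "v \<in> forest" for v
    using that root_notin_forest by (auto simp: chain_ext_def Let_def)
  have desc: "descents ?G = Inl ` descents T"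
    by (simp add: chain_ext_def Let_def)
  have spine_Inl: "spine j \<noteq> Inl v" if "v \<in> forest" for j v
    using that root_notin_forest by (auto simp: spine_def split: nat.split)
  have spine_desc: "spine j \<notin> Inl ` descents T" for j
    using root_ascent by (auto simp: spine_def split: nat.splits)
  have nonroot: "verts ?G - {root_of ?G} = Inl ` forest \<union> spine ` {..<?N}"
  proof -
    have "{..?N} = insert ?N {..<?N}" by auto
    then show ?thesis
      unfolding verts_chain_ext[OF assms] root
      using spine_Inl inj_spine by (auto simp: inj_def)
  qed
  have desc_forest: "Inl ` descents T \<subseteq> Inl ` forest"
    using descents_sub root_ascent by (auto simp: forest_def)
  have Des: "Des ?G w = Inl ` {v\<in>forest. w (Inl v) > w (Inl (parent T v))} \<union>
      spine ` {j. j < ?N \<and> w (spine j) > w (spine (Suc j))}"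
    unfolding Des_def nonroot using par_forest par_spine by auto
  have Des_eq: "Des ?G w = descents ?G \<longleftrightarrow> ?desc \<and> (\<forall>j<?N. \<not> w (spine j) > w (spine (Suc j)))"
  proof
    assume *: "Des ?G w = descents ?G"
    have "\<not> w (spine j) > w (spine (Suc j))" if "j < ?N" for j
      using * that spine_desc[of j] unfolding Des desc by blast
    moreover have "w (Inl v) > w (Inl (parent T v)) \<longleftrightarrow> v \<in> descents T" if "v \<in> forest" for v
    proof -
      have "Inl v \<in> Des ?G w \<longleftrightarrow> w (Inl v) > w (Inl (parent T v))"
        using that spine_Inl[OF that] unfolding Des
        by (metis (no_types, lifting) Inl_inject UnE UnI1 image_iff mem_Collect_eq)
      then show ?thesis using * by (auto simp: desc)
    qed
    ultimately show "?desc \<and> (\<forall>j<?N. \<not> w (spine j) > w (spine (Suc j)))" by blast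
  next
    assume *: "?desc \<and> (\<forall>j<?N. \<not> w (spine j) > w (spine (Suc j)))"
    then have "Des ?G w = Inl ` {v\<in>forest. v \<in> descents T}"
      unfolding Des by auto
    then show "Des ?G w = descents ?G"
      using desc_forest unfolding desc by auto
  qed
  have mono_iff: "(\<forall>j<?N. \<not> w (spine j) > w (spine (Suc j))) \<longleftrightarrow> ?mono" if ?bij
  proof
    assume *: "\<forall>j<?N. \<not> w (spine j) > w (spine (Suc j))"
    have step: "w (spine j) < w (spine (Suc j))" if "j < ?N" for j
    proof -
      have "spine j \<noteq> spine (Suc j)" using injD[OF inj_spine, of j "Suc j"] by auto
      then have "w (spine j) \<noteq> w (spine (Suc j))"
        using \<open>?bij\<close> that unfolding bij_betw_def inj_on_def
        by (metis UnI2 Suc_leI atMost_iff imageI less_imp_le)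
      then show ?thesis using * that by (meson linorder_neqE_nat)
    qed
    have "w (spine i) < w (spine j)" if "i < j" "j \<le> ?N" for i j
      using that
    proof (induction j)
      case (Suc j)
      then show ?case using step[of j] by (cases "i = j") auto
    qed simp
    then show ?mono by (auto simp: strict_mono_on_def)
  next
    assume ?mono
    then have "w (spine j) < w (spine (Suc j))" if "j < ?N" for j
      using strict_mono_onD[of "{..?N}" "w \<circ> spine" j "Suc j"] that by simp
    then show "\<forall>j<?N. \<not> w (spine j) > w (spine (Suc j))"
      by (meson less_asym)
  qed
  show ?thesis
    unfolding D_def labelings_def mem_Collect_eq card_verts_chain_ext[OF assms] Des_eq
    unfolding verts_chain_ext[OF assms]
    using mono_iff by blast
qed

text \<open>What remains of membership in D(T;n) after restriction to the forest. The root carries the least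
  unused label, hence a descent at a child v means that some unused label lies below the label of v.
  Asking for such a label in {1..h} loses nothing: the forest has only h labels, and one of them
  is that of v, so if the least unused label is below it then that least label is at most h.
  In this form the condition does not mention n.\<close>
definition forest_labeling :: "('a \<Rightarrow> nat) \<Rightarrow> bool" where
  "forest_labeling f \<longleftrightarrow> f \<in> extensional forest \<and> inj_on f forest \<and>
     (\<forall>v\<in>forest. if parent T v = root_of T then \<exists>m\<in>{1..h}. m \<notin> f ` forest \<and> m < f v
                else f v > f (parent T v) \<longleftrightarrow> v \<in> descents T)"

lemma forest_labeling_child:
  assumes "forest_labeling f" "v \<in> forest" "parent T v = root_of T"
  shows "\<exists>m\<in>{1..h}. m \<notin> f ` forest \<and> m < f v"
  using assms unfolding forest_labeling_def by (metis (no_types, lifting))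

lemma forest_labeling_nonchild:
  assumes "forest_labeling f" "v \<in> forest" "parent T v \<noteq> root_of T"
  shows "f v > f (parent T v) \<longleftrightarrow> v \<in> descents T"
  using assms unfolding forest_labeling_def by (metis (no_types, lifting))

definition forget :: "('a + nat \<Rightarrow> nat) \<Rightarrow> 'a \<Rightarrow> nat" where
  "forget w = restrict (w \<circ> Inl) forest"

lemma forget_image: "forget w ` forest = w ` Inl ` forest"
  by (auto simp: forget_def)

text \<open>The spine carries exactly the labels that the forest leaves free, so its increasing labeling can be
  recovered from the forest.\<close>
lemma spine_image_forget:
  assumes "n \<ge> Suc h" "w \<in> D T n"
  shows "(w \<circ> spine) ` {..n - Suc h} = {1..n} - forget w ` forest"
proof -
  let ?A = "Inl ` forest" and ?B = "spine ` {..n - Suc h}"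
  have bij: "inj_on w (?A \<union> ?B)" "w ` (?A \<union> ?B) = {1..n}"
    using assms by (auto simp: mem_D_iff bij_betw_def)
  have "?A \<inter> ?B = {}"
    using root_notin_forest by (auto simp: spine_def split: nat.splits)
  then have "w ` ?A \<inter> w ` ?B = {}"
    using bij(1) by (metis Un_upper1 Un_upper2 image_empty inj_on_image_Int)
  then show ?thesis
    using bij(2) unfolding forget_image by (auto simp: image_comp)
qed

lemma forest_labeling_forget:
  assumes "n \<ge> Suc h" "w \<in> D T n"
  shows "forest_labeling (forget w)" "forget w ` forest \<subseteq> {1..n}"
proof -
  note w = assms(2)[unfolded mem_D_iff[OF assms(1)]]
  let ?f = "forget w"
  note spine_im = spine_image_forget[OF assms]
  show sub: "?f ` forest \<subseteq> {1..n}"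
    using w unfolding forget_image bij_betw_def by blast
  have inj: "inj_on ?f forest"
    using w unfolding bij_betw_def inj_on_def forget_def by auto
  let ?r = "w (Inl (root_of T))"
  have r_img: "?r \<in> (w \<circ> spine) ` {..n - Suc h}"
    by (rule image_eqI[of _ _ 0]) auto
  then have r_notin: "?r \<notin> ?f ` forest" and r_pos: "1 \<le> ?r" unfolding spine_im by auto
  have r_min: "?r \<le> m" if "m \<in> {1..n} - ?f ` forest" for m
  proof -
    from that obtain j where j: "j \<le> n - Suc h" "m = w (spine j)"
      unfolding spine_im[symmetric] by auto
    show ?thesis
    proof (cases j)
      case (Suc i)
      then have "w (spine 0) < w (spine j)"
        using w j strict_mono_onD[of "{..n - Suc h}" "w \<circ> spine" 0 j]
        by (simp del: spine_simps)
      then show ?thesis using j by simp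
    qed (use j in simp)
  qed
  have "\<exists>m\<in>{1..h}. m \<notin> ?f ` forest \<and> m < ?f v" if "v \<in> forest" "parent T v = root_of T" for v
  proof (intro bexI conjI)
    show less: "?r < ?f v"
      using w that child_descent[OF that] by (auto simp: forget_def)
    \<comment> \<open>The labels below that of the root, and the label of v above it, are all used by the
      forest; so there are at most h of them.\<close>
    have "insert (?f v) {1..<?r} \<subseteq> ?f ` forest"
      using that r_min less sub by (force simp: not_le[symmetric])
    then have "card (insert (?f v) {1..<?r}) \<le> card (?f ` forest)"
      using fin_forest by (intro card_mono) auto
    then show "?r \<in> {1..h}"
      using less r_pos card_image[OF inj] by (simp add: h_def)
  qed (rule r_notin)
  moreover have "?f v > ?f (parent T v) \<longleftrightarrow> v \<in> descents T"
    if "v \<in> forest" "parent T v \<noteq> root_of T" for v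
  proof -
    have "parent T v \<in> forest" using that parent_in by (auto simp: forest_def)
    then show ?thesis using w that by (auto simp: forget_def)
  qed
  ultimately show "forest_labeling ?f"
    using inj unfolding forest_labeling_def by (auto simp: forget_def)
qed

lemma inj_on_forget:
  assumes "n \<ge> Suc h"
  shows "inj_on forget (D T n)"
proof (rule inj_onI)
  fix w w' assume D: "w \<in> D T n" "w' \<in> D T n" and eq: "forget w = forget w'"
  note w = D[unfolded mem_D_iff[OF assms]]
  have "(w \<circ> spine) j = (w' \<circ> spine) j" if "j \<le> n - Suc h" for j
  proof (rule strict_mono_on_atMost_unique[OF _ _ _ that])
    show "(w \<circ> spine) ` {..n - Suc h} = (w' \<circ> spine) ` {..n - Suc h}"
      unfolding spine_image_forget[OF assms D(1)] spine_image_forget[OF assms D(2)] eq ..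
  qed (use w in blast)+
  moreover have "w (Inl v) = w' (Inl v)" if "v \<in> forest" for v
    using fun_cong[OF eq, of v] that by (simp add: forget_def)
  ultimately show "w = w'"
    using w by (intro extensionalityI[of w "Inl ` forest \<union> spine ` {..n - Suc h}"]) auto
qed

text \<open>The free labels are placed on the spine in increasing order.\<close>
lemma forget_surj:
  assumes "n \<ge> Suc h" "forest_labeling f" "f ` forest \<subseteq> {1..n}"
  shows "f \<in> forget ` D T n"
proof -
  let ?N = "n - Suc h"
  let ?C = "{1..n} - f ` forest"
  have f: "f \<in> extensional forest" "inj_on f forest"
    using assms(2) by (auto simp: forest_labeling_def)
  have "card ?C = card {..?N}"
    using assms fin_forest f by (simp add: card_Diff_subset card_image h_def)
  then obtain g where g: "strict_mono_on {..?N} g" "bij_betw g {..?N} ?C"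
    using ex_strict_mono_bij[of "{..?N}" ?C]
    by (metis finite_Diff finite_atMost finite_atLeastAtMost)
  have g0: "g 0 \<le> m" if m: "m \<in> ?C" for m
  proof -
    have "m \<in> g ` {..?N}" using g(2) m by (simp add: bij_betw_def)
    then obtain j where j: "j \<le> ?N" "m = g j" by auto
    show ?thesis
      using strict_mono_onD[OF g(1), of 0 j] j by (cases "j = 0") auto
  qed
  define w where "w = restrict (\<lambda>x. case x of Inl v \<Rightarrow> if v = root_of T then g 0 else f v
      | Inr i \<Rightarrow> g (Suc i)) (Inl ` forest \<union> spine ` {..?N})"
  have w_spine: "w (spine j) = g j" if "j \<le> ?N" for j
  proof -
    have "spine j \<in> Inl ` forest \<union> spine ` {..?N}" using that by blast
    then have "w (spine j) = (case spine j of Inl v \<Rightarrow> if v = root_of T then g 0 else f v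
        | Inr i \<Rightarrow> g (Suc i))"
      unfolding w_def by (simp only: restrict_apply if_True)
    then show ?thesis by (cases j) simp_all
  qed
  have w_forest: "w (Inl v) = f v" if "v \<in> forest" for v
    using that root_notin_forest unfolding w_def by auto
  have forget: "forget w = f"
    using f(1) w_forest by (auto simp: forget_def restrict_def extensional_def fun_eq_iff)
  have "bij_betw w (Inl ` forest \<union> spine ` {..?N}) (f ` forest \<union> ?C)"
  proof (rule bij_betw_combine)
    have "bij_betw (w \<circ> spine) {..?N} ?C"
      using g(2) w_spine by (subst bij_betw_cong[of _ _ g]) auto
    then show "bij_betw w (spine ` {..?N}) ?C"
      using inj_spine by (auto simp: bij_betw_def inj_on_def image_comp)
    have "bij_betw (w \<circ> Inl) forest (f ` forest)"
      using f(2) w_forest by (subst bij_betw_cong[of _ _ f]) (auto simp: bij_betw_def)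
    then show "bij_betw w (Inl ` forest) (f ` forest)"
      by (auto simp: bij_betw_def inj_on_def image_comp)
  qed auto
  moreover have "f ` forest \<union> ?C = {1..n}" using assms(3) by auto
  moreover have "strict_mono_on {..?N} (w \<circ> spine)"
    using g(1) w_spine by (auto simp: strict_mono_on_def)
  moreover have "w (Inl v) > w (Inl (parent T v)) \<longleftrightarrow> v \<in> descents T" if "v \<in> forest" for v
  proof (cases "parent T v = root_of T")
    case True
    then obtain m where m: "m \<in> {1..h}" "m \<notin> f ` forest" "m < f v"
      using forest_labeling_child[OF assms(2) \<open>v \<in> forest\<close> True] by blast
    then have "g 0 < f v" using g0[of m] assms(1) by auto
    then show ?thesis
      using True that child_descent w_forest w_spine[of 0] by auto
  next
    case False
    then have "parent T v \<in> forest" using that parent_in by (auto simp: forest_def)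
    then show ?thesis using False that forest_labeling_nonchild[OF assms(2)] w_forest by simp
  qed
  ultimately have "w \<in> D T n"
    unfolding mem_D_iff[OF assms(1)] by (auto simp: w_def)
  then show ?thesis using forget by blast
qed

lemma bij_betw_forget:
  assumes "n \<ge> Suc h"
  shows "bij_betw forget (D T n) {f. forest_labeling f \<and> f ` forest \<subseteq> {1..n}}"
  unfolding bij_betw_def
  using inj_on_forget[OF assms] forest_labeling_forget[OF assms] forget_surj[OF assms] by blast

section \<open>Sorting forest labelings by their labels above h\<close>

definition forest_labelings_with :: "nat set \<Rightarrow> ('a \<Rightarrow> nat) set" where
  "forest_labelings_with B = {f. forest_labeling f \<and> f ` forest - {1..h} = B}"

lemma finite_forest_labelings_with:
  assumes "finite B"
  shows "finite (forest_labelings_with B)"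
proof (rule finite_subset)
  show "forest_labelings_with B \<subseteq> (forest \<rightarrow>\<^sub>E {1..h} \<union> B)"
    by (auto simp: forest_labelings_with_def forest_labeling_def PiE_def)
  show "finite (forest \<rightarrow>\<^sub>E {1..h} \<union> B)"
    using assms fin_forest by (intro finite_PiE) auto
qed

text \<open>Relabeling by the map that fixes {1..h} and carries B monotonically onto B' preserves
  every condition: comparisons survive because the map is strictly increasing, and the unused labels
  in {1..h} that serve the children of the root are not moved. By symmetry, the number of
  labelings depends only on the size of B.\<close>
lemma card_forest_labelings_with_le:
  assumes "finite B" "finite B'" "card B = card B'" "\<forall>b\<in>B. h < b" "\<forall>b\<in>B'. h < b"
  shows "card (forest_labelings_with B) \<le> card (forest_labelings_with B')"
proof -
  obtain g0 where g0: "strict_mono_on B g0" "bij_betw g0 B B'"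
    using assms(1-3) by (rule ex_strict_mono_bij)
  define g where "g x = (if x \<le> h then x else g0 x)" for x
  have g_big: "g x \<in> B'" "h < g x" if "x \<in> B" for x
    using that assms(4,5) g0(2) by (auto simp: g_def bij_betw_def)
  have g_small: "g x = x" if "x \<le> h" for x using that by (simp add: g_def)
  have mono: "strict_mono_on ({1..h} \<union> B) g"
  proof (rule strict_mono_onI)
    fix x y assume "x \<in> {1..h} \<union> B" "y \<in> {1..h} \<union> B" "x < y"
    then show "g x < g y"
      using g_big[of y] g_small[of x] g_small[of y] assms(4) strict_mono_onD[OF g0(1), of x y]
      by (cases "y \<le> h"; cases "x \<le> h") (auto simp: g_def)
  qed
  then have inj: "inj_on g ({1..h} \<union> B)" by (rule strict_mono_on_imp_inj_on)
  have less_iff: "g x < g y \<longleftrightarrow> x < y" if "x \<in> {1..h} \<union> B" "y \<in> {1..h} \<union> B" for x y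
    using mono that by (rule strict_mono_on_less)
  have im_g: "g ` B = B'"
    using assms(4) g0(2) by (force simp: g_def bij_betw_def)
  define \<Phi> where "\<Phi> f = restrict (g \<circ> f) forest" for f :: "'a \<Rightarrow> nat"
  have range: "f v \<in> {1..h} \<union> B" if "f \<in> forest_labelings_with B" "v \<in> forest" for f v
    using that by (auto simp: forest_labelings_with_def)
  have "\<Phi> f \<in> forest_labelings_with B'" if f: "f \<in> forest_labelings_with B" for f
  proof -
    have c: "forest_labeling f" and B: "f ` forest - {1..h} = B"
      using f by (auto simp: forest_labelings_with_def)
    have sub: "f ` forest \<subseteq> {1..h} \<union> B" using B by auto
    have im: "\<Phi> f ` forest = g ` f ` forest" by (auto simp: \<Phi>_def)
    have "f ` forest = (f ` forest \<inter> {1..h}) \<union> B" using B by auto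
    then have "g ` f ` forest = g ` (f ` forest \<inter> {1..h}) \<union> g ` B" by (metis image_Un)
    also have "g ` (f ` forest \<inter> {1..h}) = f ` forest \<inter> {1..h}" by (force simp: g_small)
    finally have im2: "\<Phi> f ` forest = (f ` forest \<inter> {1..h}) \<union> B'" unfolding im im_g .
    have "inj_on (g \<circ> f) forest"
      using c inj_on_subset[OF inj sub] by (intro comp_inj_on) (auto simp: forest_labeling_def)
    then have "inj_on (\<Phi> f) forest" by (simp add: \<Phi>_def inj_on_def)
    moreover have "\<exists>m\<in>{1..h}. m \<notin> \<Phi> f ` forest \<and> m < \<Phi> f v"
      if v: "v \<in> forest" "parent T v = root_of T" for v
    proof -
      obtain m where m: "m \<in> {1..h}" "m \<notin> f ` forest" "m < f v"
        using forest_labeling_child[OF c v] by blast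
      have "m \<notin> \<Phi> f ` forest" using m assms(5) unfolding im2 by auto
      moreover have "m < \<Phi> f v"
        using less_iff[of m "f v"] m range[OF f v(1)] g_small[of m] v by (simp add: \<Phi>_def)
      ultimately show ?thesis using m by blast
    qed
    moreover have "\<Phi> f v > \<Phi> f (parent T v) \<longleftrightarrow> v \<in> descents T"
      if v: "v \<in> forest" "parent T v \<noteq> root_of T" for v
    proof -
      have p: "parent T v \<in> forest" using v parent_in by (auto simp: forest_def)
      then show ?thesis
        using forest_labeling_nonchild[OF c v] v less_iff[OF range[OF f p] range[OF f v(1)]]
        by (simp add: \<Phi>_def)
    qed
    ultimately have "forest_labeling (\<Phi> f)" unfolding forest_labeling_def by (auto simp: \<Phi>_def)
    moreover have "\<Phi> f ` forest - {1..h} = B'" unfolding im2 using assms(5) by auto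
    ultimately show ?thesis by (simp add: forest_labelings_with_def)
  qed
  moreover have "inj_on \<Phi> (forest_labelings_with B)"
  proof (rule inj_onI)
    fix f f' assume f: "f \<in> forest_labelings_with B" "f' \<in> forest_labelings_with B"
      and eq: "\<Phi> f = \<Phi> f'"
    have "f v = f' v" if "v \<in> forest" for v
      using fun_cong[OF eq, of v] that inj_onD[OF inj _ range[OF f(1) that] range[OF f(2) that]]
      by (simp add: \<Phi>_def)
    then show "f = f'"
      using f by (intro extensionalityI[of f forest])
        (auto simp: forest_labelings_with_def forest_labeling_def)
  qed
  ultimately show ?thesis
    using finite_forest_labelings_with[OF assms(2)] by (intro card_inj_on_le[of \<Phi>]) auto
qed

text \<open>With n = 2h there is room above h for exactly the h labels of the forest, which is why all
  coefficients up to index h can be read off from D(T;2h).\<close>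
lemma a_coeff_eq_card_forest_labelings:
  assumes "k \<le> h" "finite B" "card B = k" "\<forall>b\<in>B. h < b"
  shows "a_coeff T k = card (forest_labelings_with B)"
proof -
  have n: "2 * h \<ge> Suc h" using h_pos by simp
  let ?S = "{w \<in> D T (2 * h). w ` Inl ` forest \<inter> {h+1..2*h} = {h+1..h+k}}"
  have "forest_labelings_with {h+1..h+k} = forget ` ?S"
  proof -
    have *: "X \<inter> {h+1..2*h} = X - {1..h}" if "X \<subseteq> {1..2*h}" for X
      using that by auto
    have "forest_labelings_with {h+1..h+k} = {f. (forest_labeling f \<and> f ` forest \<subseteq> {1..2*h}) \<and>
        f ` forest \<inter> {h+1..2*h} = {h+1..h+k}}"
    proof -
      have "f ` forest \<subseteq> {1..2*h}" if "f ` forest - {1..h} = {h+1..h+k}" for f :: "'a \<Rightarrow> nat"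
      proof -
        have "f ` forest \<subseteq> {1..h} \<union> {h+1..h+k}" using that by blast
        also have "\<dots> \<subseteq> {1..2*h}" using assms(1) by auto
        finally show ?thesis .
      qed
      then have "forest_labeling f \<and> f ` forest - {1..h} = {h+1..h+k} \<longleftrightarrow>
          (forest_labeling f \<and> f ` forest \<subseteq> {1..2*h}) \<and> f ` forest \<inter> {h+1..2*h} = {h+1..h+k}" for f
        using *[of "f ` forest"] by metis
      then show ?thesis unfolding forest_labelings_with_def by (rule Collect_cong)
    qed
    also have "\<dots> = {f \<in> forget ` D T (2*h). f ` forest \<inter> {h+1..2*h} = {h+1..h+k}}"
      unfolding bij_betw_imp_surj_on[OF bij_betw_forget[OF n]] by blast
    also have "\<dots> = forget ` {w \<in> D T (2*h). forget w ` forest \<inter> {h+1..2*h} = {h+1..h+k}}"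
      by blast
    also have "\<dots> = forget ` ?S" by (simp only: forget_image)
    finally show ?thesis .
  qed
  moreover have "inj_on forget ?S"
    using inj_on_forget[OF n] by (rule inj_on_subset) auto
  ultimately have "card ?S = card (forest_labelings_with {h+1..h+k})" by (simp add: card_image)
  moreover have "a_coeff T k = card ?S"
    by (simp add: a_coeff_def Let_def card_verts flip: forest_def)
  moreover have "card (forest_labelings_with {h+1..h+k}) = card (forest_labelings_with B)"
    using assms by (intro antisym card_forest_labelings_with_le) auto
  ultimately show ?thesis by simp
qed

section \<open>Existence of forest labelings\<close>

definition depth :: "'a \<Rightarrow> nat" where
  "depth v = (LEAST i. (parent T ^^ i) v = root_of T)"

lemma depth_reaches: "v \<in> verts T \<Longrightarrow> (parent T ^^ depth v) v = root_of T"
  unfolding depth_def using tree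
  by (intro LeastI_ex[where P = "\<lambda>i. (parent T ^^ i) v = root_of T"]) (simp add: rooted_tree_def)

lemma depth_parent:
  assumes "v \<in> forest"
  shows "depth v = Suc (depth (parent T v))"
proof -
  have "(parent T ^^ depth v) v = root_of T"
    using depth_reaches assms by (simp add: forest_def)
  moreover have "(parent T ^^ 0) v \<noteq> root_of T" using assms by (simp add: forest_def)
  ultimately have "depth v = Suc (LEAST j. (parent T ^^ Suc j) v = root_of T)"
    unfolding depth_def[of v]
    by (rule Least_Suc[where P = "\<lambda>i. (parent T ^^ i) v = root_of T"])
  also have "(LEAST j. (parent T ^^ Suc j) v = root_of T) = depth (parent T v)"
    unfolding depth_def[of "parent T v"] funpow_Suc_right o_apply by (rule refl)
  finally show ?thesis .
qed

lemma ex_child: "\<exists>v\<in>forest. parent T v = root_of T"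
proof -
  \<comment> \<open>A vertex of least depth in the forest has its parent outside the forest.\<close>
  have "forest \<noteq> {}" using h_pos unfolding h_def by force
  then obtain v where v: "v \<in> forest" "\<And>u. u \<in> forest \<Longrightarrow> depth v \<le> depth u"
    using ex_min_if_finite[of "depth ` forest"] fin_forest by (auto simp: not_less)
  have "parent T v \<notin> forest"
    using v(2)[of "parent T v"] depth_parent[OF v(1)] by linarith
  then have "parent T v = root_of T" using parent_in[OF v(1)] by (simp add: forest_def)
  with v(1) show ?thesis by (rule rev_bexI)
qed

text \<open>Without labels above h the forest uses up all of {1..h}, and nothing is left to lie below a child of
  the root. This is why the sum for d(T;n) has no constant term.\<close>
lemma forest_labelings_with_empty: "forest_labelings_with {} = {}"
proof -
  have False if f: "forest_labeling f" "f ` forest - {1..h} = {}" for f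
  proof -
    have "card (f ` forest) = card {1..h}"
      using f by (simp add: forest_labeling_def card_image h_def)
    moreover have "f ` forest \<subseteq> {1..h}" using f(2) by blast
    ultimately have "f ` forest = {1..h}" by (intro card_subset_eq) simp_all
    moreover obtain u where "u \<in> forest" "parent T u = root_of T" using ex_child by blast
    then obtain m where "m \<in> {1..h}" "m \<notin> f ` forest" using forest_labeling_child[OF f(1)] by blast
    ultimately show False by simp
  qed
  then show ?thesis unfolding forest_labelings_with_def by blast
qed

text \<open>Walking up to the root and counting +1 for each descent vertex and -1 for each ascent vertex gives an
  integer that compares each vertex with its parent as prescribed. Breaking its ties by an
  enumeration of the forest gives distinct keys, whose order is a labeling by {h+1..2h}; then the
  label 1 is unused and lies below every child of the root.\<close>
lemma a_coeff_top_pos: "a_coeff T h > 0"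
proof -
  define sgn where "sgn v = (if v \<in> descents T then 1 else - 1 :: int)" for v
  define height where "height v = (\<Sum>j<depth v. sgn ((parent T ^^ j) v))" for v
  have height_parent: "height v = sgn v + height (parent T v)" if "v \<in> forest" for v
    unfolding height_def depth_parent[OF that] sum.lessThan_Suc_shift
    by (simp add: funpow_Suc_right del: funpow.simps)
  obtain e :: "'a \<Rightarrow> nat" where e: "inj_on e forest" "e ` forest \<subseteq> {..<h}"
    using ex_bij_betw_finite_nat[OF fin_forest] unfolding bij_betw_def h_def atLeast0LessThan
    by blast
  \<comment> \<open>Lexicographic comparison of height and enumeration index, packed into one integer;
    it is faithful because the index is less than h.\<close>
  define key where "key v = (height v * int h + int (e v))" for v
  have key_less: "key u < key v" if "height u < height v" "u \<in> forest" "v \<in> forest" for u v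
  proof -
    have "e u < h" using e that by auto
    then have "key u < (height u + 1) * int h" by (simp add: key_def algebra_simps)
    also have "\<dots> \<le> height v * int h" using that by (intro mult_right_mono) auto
    also have "\<dots> \<le> key v" by (simp add: key_def)
    finally show ?thesis .
  qed
  have inj_key: "inj_on key forest"
  proof (rule inj_onI)
    fix u v assume uv: "u \<in> forest" "v \<in> forest" "key u = key v"
    then have "height u = height v"
      using key_less[of u v] key_less[of v u] by linarith
    then show "u = v" using uv e(1) by (auto simp: key_def dest: inj_onD)
  qed
  have "card (key ` forest) = card {h+1..2*h}" by (simp add: card_image[OF inj_key] h_def)
  then obtain g where g: "strict_mono_on (key ` forest) g" "bij_betw g (key ` forest) {h+1..2*h}"
    using fin_forest ex_strict_mono_bij[of "key ` forest" "{h+1..2*h}"]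
    by (metis finite_imageI finite_atLeastAtMost)
  define f where "f = restrict (g \<circ> key) forest"
  have im: "f ` forest = {h+1..2*h}"
    using g(2) by (auto simp: f_def bij_betw_def)
  have "forest_labeling f"
    unfolding forest_labeling_def
  proof (intro conjI ballI)
    show "f \<in> extensional forest" by (simp add: f_def)
    show "inj_on f forest"
      using inj_key g(2) by (auto simp: f_def bij_betw_def inj_on_def)
  next
    fix v assume v: "v \<in> forest"
    show "if parent T v = root_of T then \<exists>m\<in>{1..h}. m \<notin> f ` forest \<and> m < f v
                else f v > f (parent T v) \<longleftrightarrow> v \<in> descents T"
    proof (cases "parent T v = root_of T")
      case True
      have "f v \<in> {h+1..2*h}" using v im by blast
      then have "1 \<in> {1..h}" "1 \<notin> f ` forest" "1 < f v" using h_pos unfolding im by auto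
      then show ?thesis using True by auto
    next
      case False
      then have p: "parent T v \<in> forest" using v parent_in by (auto simp: forest_def)
      have "key v > key (parent T v) \<longleftrightarrow> v \<in> descents T"
      proof (cases "v \<in> descents T")
        case True
        then have "height (parent T v) < height v" using height_parent[OF v] by (simp add: sgn_def)
        then show ?thesis using True key_less[OF _ p v] by simp
      next
        case False
        then have "height v < height (parent T v)" using height_parent[OF v] by (simp add: sgn_def)
        then show ?thesis using False key_less[OF _ v p] by simp
      qed
      moreover have "f v > f (parent T v) \<longleftrightarrow> key v > key (parent T v)"
        using v p strict_mono_on_less[OF g(1)] by (simp add: f_def)
      ultimately show ?thesis using False by simp
    qed
  qed
  then have "f \<in> forest_labelings_with {h+1..2*h}" using im by (auto simp: forest_labelings_with_def)
  then have "card (forest_labelings_with {h+1..2*h}) > 0"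
    using finite_forest_labelings_with[of "{h+1..2*h}"] by (auto simp: card_gt_0_iff)
  then show ?thesis
    using a_coeff_eq_card_forest_labelings[of h "{h+1..2*h}"] by simp
qed

section \<open>The counting formula and its polynomial\<close>

lemma d_eq_sum:
  assumes "n \<ge> Suc h"
  shows "d T n = (\<Sum>k=1..h. a_coeff T k * ((n - h) choose k))"
proof -
  let ?Q = "{B. B \<subseteq> {h+1..n} \<and> card B \<in> {1..h}}"
  have fin: "finite B" if "B \<subseteq> {h+1..n}" for B using that finite_subset by blast
  have "d T n = card {f. forest_labeling f \<and> f ` forest \<subseteq> {1..n}}"
    unfolding d_def using bij_betw_same_card[OF bij_betw_forget[OF assms]] .
  also have "{f. forest_labeling f \<and> f ` forest \<subseteq> {1..n}} = (\<Union>B\<in>?Q. forest_labelings_with B)"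
  proof (intro equalityI subsetI)
    fix f assume f: "f \<in> {f. forest_labeling f \<and> f ` forest \<subseteq> {1..n}}"
    let ?B = "f ` forest - {1..h}"
    have "f \<in> forest_labelings_with ?B" using f by (simp add: forest_labelings_with_def)
    then have "?B \<noteq> {}" using forest_labelings_with_empty by (metis empty_iff)
    then have "card ?B \<noteq> 0" using fin_forest by (metis card_0_eq finite_Diff finite_imageI)
    moreover have "card ?B \<le> h"
      using card_mono[of "f ` forest" ?B] fin_forest card_image_le[OF fin_forest, of f]
      by (simp add: h_def)
    moreover have "?B \<subseteq> {h+1..n}" using f by force
    ultimately have "?B \<in> ?Q" by simp
    then show "f \<in> (\<Union>B\<in>?Q. forest_labelings_with B)"
      using \<open>f \<in> forest_labelings_with ?B\<close> by (rule UN_I)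
  next
    fix f assume "f \<in> (\<Union>B\<in>?Q. forest_labelings_with B)"
    then obtain B where B: "B \<subseteq> {h+1..n}" "forest_labeling f" "f ` forest - {1..h} = B"
      by (auto simp: forest_labelings_with_def)
    have "f ` forest \<subseteq> {1..h} \<union> {h+1..n}" using B by blast
    also have "\<dots> = {1..n}" using assms by auto
    finally show "f \<in> {f. forest_labeling f \<and> f ` forest \<subseteq> {1..n}}" using B by simp
  qed
  also have "card \<dots> = (\<Sum>B\<in>?Q. card (forest_labelings_with B))"
    by (rule card_UN_disjoint)
      (use fin finite_forest_labelings_with in \<open>auto simp: forest_labelings_with_def\<close>)
  also have "\<dots> = (\<Sum>B\<in>?Q. a_coeff T (card B))"
  proof (rule sum.cong[OF refl])
    fix B assume B: "B \<in> ?Q"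
    then have "\<forall>b\<in>B. h < b" by auto
    with B show "card (forest_labelings_with B) = a_coeff T (card B)"
      using fin a_coeff_eq_card_forest_labelings[of "card B" B] by simp
  qed
  also have "\<dots> = (\<Sum>k=1..h. \<Sum>B\<in>{B\<in>?Q. card B = k}. a_coeff T (card B))"
    by (rule sum.group[symmetric]) auto
  also have "\<dots> = (\<Sum>k=1..h. a_coeff T k * ((n - h) choose k))"
  proof (rule sum.cong[OF refl])
    fix k assume k: "k \<in> {1..h}"
    then have "{B\<in>?Q. card B = k} = {B. B \<subseteq> {h+1..n} \<and> card B = k}" by auto
    then have "card {B\<in>?Q. card B = k} = (n - h) choose k" by (simp add: n_subsets)
    moreover have "(\<Sum>B\<in>{B\<in>?Q. card B = k}. a_coeff T (card B)) =
        (\<Sum>B\<in>{B\<in>?Q. card B = k}. a_coeff T k)"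
      by (rule sum.cong) auto
    ultimately show "(\<Sum>B\<in>{B\<in>?Q. card B = k}. a_coeff T (card B)) =
        a_coeff T k * ((n - h) choose k)"
      by (simp only: sum_constant of_nat_id mult.commute)
  qed
  finally show ?thesis .
qed

end

definition choose_poly :: "nat \<Rightarrow> 'a::field_char_0 poly" where
  "choose_poly k = smult (1 / fact k) (\<Prod>i<k. [:- of_nat i, 1:])"

lemma poly_choose_poly: "poly (choose_poly k) x = x gchoose k"
  by (simp add: choose_poly_def gbinomial_prod_rev poly_prod atLeast0LessThan)

lemma degree_choose_poly: "degree (choose_poly k :: 'a::field_char_0 poly) = k"
proof -
  have "degree (\<Prod>i<k. [:- of_nat i, 1::'a:]) = (\<Sum>i<k. degree [:- of_nat i, 1::'a:])"
    by (rule degree_prod_eq_sum_degree) simp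
  then show ?thesis by (simp add: choose_poly_def)
qed

lemma poly_eqI_eventually:
  fixes p q :: "'a::field_char_0 poly"
  assumes "\<And>n. n \<ge> N \<Longrightarrow> poly p (of_nat n) = poly q (of_nat n)"
  shows "p = q"
proof (rule ccontr)
  assume "p \<noteq> q"
  then have "finite {x. poly (p - q) x = 0}" by (intro poly_roots_finite) simp
  moreover have "of_nat ` {N..} \<subseteq> {x. poly (p - q) x = 0}" using assms by auto
  ultimately have "finite (of_nat ` {N..} :: 'a set)" by (rule finite_subset[rotated])
  then have "finite {N..}" by (rule finite_imageD) (simp add: inj_on_def)
  then show False using infinite_Ici by blast
qed

theorem theorem3p1:
  fixes T :: "'a dtree" and s h :: nat
  assumes "rooted_tree T"
    and "s = card (verts T)" and "s \<ge> 2" and "h = s - 1"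
    and "root_of T \<notin> descents T"
    and "children T (root_of T) \<subseteq> descents T"
  shows "(\<forall>n \<ge> s. poly (d_poly T) (of_nat n) = of_nat (d T n)) \<and>
         degree (d_poly T) = h \<and>
         (\<forall>x :: rat. poly (d_poly T) x =
            (\<Sum>k = 1..h. of_nat (a_coeff T k) * ((x - of_nat h) gchoose k)))"
proof -
  interpret t: tree_with_descent_children T
    using assms by unfold_locales auto
  have h: "h = t.h" "s = Suc h" using assms t.card_verts by auto
  define summand where
    "summand k = smult (of_nat (a_coeff T k)) (choose_poly k \<circ>\<^sub>p [:- of_nat h, 1 :: rat:])" for k
  define q where "q = (\<Sum>k=1..h. summand k)"
  have q: "poly q x = (\<Sum>k = 1..h. of_nat (a_coeff T k) * ((x - of_nat h) gchoose k))" for x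
    by (simp add: q_def summand_def poly_sum poly_pcompose poly_choose_poly)
  have q_nat: "poly q (of_nat n) = of_nat (d T n)" if "n \<ge> s" for n
  proof -
    have "(of_nat n - of_nat h :: rat) gchoose k = of_nat ((n - h) choose k)" for k
      using that h by (simp add: binomial_gbinomial of_nat_diff)
    then show ?thesis
      using that h t.d_eq_sum[of n] by (simp add: q)
  qed
  have d_poly: "d_poly T = q"
    unfolding d_poly_def assms(2)[symmetric]
  proof (rule the_equality)
    fix p :: "rat poly" assume "\<forall>n\<ge>s. poly p (of_nat n) = of_nat (d T n)"
    then show "p = q" using q_nat by (intro poly_eqI_eventually[of s]) simp
  qed (use q_nat in simp)
  have "degree q = h"
  proof -
    obtain j where j: "h = Suc j" using t.h_pos h(1) by (metis Suc_le_D One_nat_def)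
    have degree_comp: "degree (choose_poly k \<circ>\<^sub>p [:- of_nat h, 1 :: rat:]) = k" for k
      by (simp add: degree_pcompose degree_choose_poly)
    have "degree (summand k) \<le> k" for k
      unfolding summand_def using degree_smult_le degree_comp by metis
    then have "degree (\<Sum>k=1..j. summand k) \<le> j"
      by (intro degree_sum_le) (auto intro: order_trans)
    then have "degree (\<Sum>k=1..j. summand k) < h" by (simp add: j)
    moreover have "degree (summand h) = h"
      using t.a_coeff_top_pos h(1) degree_comp by (simp add: summand_def)
    ultimately have "degree ((\<Sum>k=1..j. summand k) + summand h) = h"
      by (subst degree_add_eq_right) auto
    then show ?thesis by (simp add: q_def j)
  qed
  then show ?thesis using q q_nat unfolding d_poly by blast
qed

end
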